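(* Let $f:\mathbb{R}^n\to\mathbb{R}$ be a Lipschitz quasidifferentiable function whose subdifferential and superdifferential mappings $\underline{\partial}f(\cdot)$ and $\overline{\partial}f(\cdot)$ are upper semicontinuous, as set-valued mappings, at $x\in\mathbb{R}^n$ (and, consequently, the set-valued mapping $Df(\cdot)$ is upper semicontinuous). Then $f$ is continuously codifferentiable at $x$.
   Context: $f$ is quasidifferentiable at $y$ if there are convex compact sets $\underline{\partial}f(y),\overline{\partial}f(y)\subset\mathbb{R}^n$ (subdifferential and superdifferential) with $f(y+\Delta)=f(y)+\max_{v\in\underline{\partial}f(y)}(v,\Delta)+\min_{w\in\overline{\partial}f(y)}(w,\Delta)+o_y(\Delta)$, where $o_y(\Delta)\to 0$ as $\Delta\to0$ and $o_y(\alpha\Delta)/\alpha\to0$ as $\alpha\to+0$; $f$ is quasidifferentiable if this holds at every point. $f$ is codifferentiable at $y$ if there are convex compact sets $\underline{d}f(y),\overline{d}f(y)\subset\mathbb{R}^{n+1}=\mathbb{R}\times\mathbb{R}^n$ (hypodifferential and hyperdifferential) with $$f(y+\Delta)=f(y)+\max_{[a,v]\in\underline{d}f(y)}[a+(v,\Delta)]+\min_{[b,w]\in\overline{d}f(y)}[b+(w,\Delta)]+o_y(\Delta),$$ with $o_y$ as before; the pair $[\underline{d}f(y),\overline{d}f(y)]$ is a (first) codifferential of $f$ at $y$. $f$ is continuously codifferentiable at $x$ if it is codifferentiable in a neighborhood of $x$ and the codifferentials can be chosen so that $y\mapsto[\underline{d}f(y),\overline{d}f(y)]$ is continuous at $x$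 in the Hausdorff metric. The set $Df(x_0)$ (for Lipschitz $f$): let $S_1^{n-1}(0)=\{v\in\mathbb{R}^n:\|v\|=1\}$. Let $\eta(x_0)$ be the set of smooth curves $r(x_0,\alpha,g)=x_0+\alpha g+o_r(\alpha)$, $g\in S_1^{n-1}(0)$, where $o_r:[0,\alpha_0]\to\mathbb{R}^n$, $\alpha_0>0$, satisfies: (1) $o_r(\alpha)/\alpha\to0$ as $\alpha\downarrow0$ uniformly in $r(\cdot)$; (2) $o_r$ has a continuous derivative $o_r'$, and there is $c<\infty$ such that $\sup_{\tau\in(0,\alpha_0)}\|o_r'(\tau)\|\le c$ for all $r$; (3) the gradient $\nabla f(r(\cdot))$ exists almost everywhere along the curve $r(x_0,\cdot,g)$. Put $$Ef(x_0)=\Big\{v\in\mathbb{R}^n:\ \exists \alpha_k\downarrow0,\ \exists g\in S_1^{n-1}(0),\ \exists r(x_0,\cdot,g)\in\eta(x_0),\ v=\lim_{k\to\infty}\alpha_k^{-1}\int_0^{\alpha_k}\nabla f(r(x_0,\tau,g))\,d\tau\Big\}$$ and $Df(x_0)=\operatorname{conv}Ef(x_0)$.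
   Formalization: The parenthetical claim that Df(·) is consequently upper semicontinuous is dropped: for arbitrary, non-minimal choices of the sub- and superdifferential it is false. It is not assumed either; continuous codifferentiability at x is proved in full. *)

theory Defs
  imports "HOL-Analysis.Analysis"
begin

definition is_remainder :: "('a::euclidean_space \<Rightarrow> real) \<Rightarrow> bool" where
  "is_remainder r \<longleftrightarrow>
     (r \<longlongrightarrow> 0) (at 0) \<and>
     (\<forall>\<Delta>. ((\<lambda>\<alpha>. r (\<alpha> *\<^sub>R \<Delta>) / \<alpha>) \<longlongrightarrow> 0) (at_right 0))"

(* Since the sets below are nonempty and compact, the SUP and INF are attained,
   so they are the max and min of the expansions. *)

definition has_quasidifferential ::
  "('a::euclidean_space \<Rightarrow> real) \<Rightarrow> 'a \<Rightarrow> 'a set \<Rightarrow> 'a set \<Rightarrow> bool" where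
  "has_quasidifferential f y A B \<longleftrightarrow>
     convex A \<and> compact A \<and> A \<noteq> {} \<and> convex B \<and> compact B \<and> B \<noteq> {} \<and>
     (\<exists>r. is_remainder r \<and>
        (\<forall>\<Delta>. f (y + \<Delta>) =
               f y + (SUP v\<in>A. v \<bullet> \<Delta>) + (INF w\<in>B. w \<bullet> \<Delta>) + r \<Delta>))"

definition has_codifferential ::
  "('a::euclidean_space \<Rightarrow> real) \<Rightarrow> 'a \<Rightarrow> (real \<times> 'a) set \<Rightarrow> (real \<times> 'a) set \<Rightarrow> bool" where
  "has_codifferential f y A B \<longleftrightarrow>
     convex A \<and> compact A \<and> A \<noteq> {} \<and> convex B \<and> compact B \<and> B \<noteq> {} \<and>
     (\<exists>r. is_remainder r \<and>
        (\<forall>\<Delta>. f (y + \<Delta>) =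
               f y + (SUP (a, v)\<in>A. a + v \<bullet> \<Delta>) + (INF (b, w)\<in>B. b + w \<bullet> \<Delta>) + r \<Delta>))"

(* Only meaningful for nonempty bounded sets, which is all it is used for. *)
definition hausdorff_distance :: "'a::metric_space set \<Rightarrow> 'a set \<Rightarrow> real" where
  "hausdorff_distance A B = max (SUP a\<in>A. infdist a B) (SUP b\<in>B. infdist b A)"

definition hausdorff_continuous_at ::
  "('a::topological_space \<Rightarrow> 'b::metric_space set) \<Rightarrow> 'a \<Rightarrow> bool" where
  "hausdorff_continuous_at F x \<longleftrightarrow> ((\<lambda>y. hausdorff_distance (F y) (F x)) \<longlongrightarrow> 0) (at x)"

definition upper_semicontinuous_at ::
  "('a::topological_space \<Rightarrow> 'b::topological_space set) \<Rightarrow> 'a \<Rightarrow> bool" where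
  "upper_semicontinuous_at F x \<longleftrightarrow>
     (\<forall>V. open V \<and> F x \<subseteq> V \<longrightarrow> (\<forall>\<^sub>F y in nhds x. F y \<subseteq> V))"

(* The values of the two mappings outside U are irrelevant, because U is open. *)
definition continuously_codifferentiable_at ::
  "('a::euclidean_space \<Rightarrow> real) \<Rightarrow> 'a \<Rightarrow> bool" where
  "continuously_codifferentiable_at f x \<longleftrightarrow>
     (\<exists>U hypo hyper. open U \<and> x \<in> U \<and>
        (\<forall>y\<in>U. has_codifferential f y (hypo y) (hyper y)) \<and>
        hausdorff_continuous_at hypo x \<and> hausdorff_continuous_at hyper x)"

end

theory Submission
  imports Defs
begin

text \<open>
  Keep the quasidifferential of \<open>y\<close> at height 0 and attach the one of \<open>x\<close> at height
  \<open>-|y - x|\<close> (for the superdifferential, at height \<open>|y - x|\<close>). The attached part is inactive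
  for all sufficiently small increments, so the convex hull is still a codifferential at \<open>y\<close>,
  and it restores lower semicontinuity at \<open>x\<close>, while upper semicontinuity is assumed.
\<close>

definition attach :: "real \<Rightarrow> 'a::euclidean_space set \<Rightarrow> 'a set \<Rightarrow> (real \<times> 'a) set" where
  "attach \<delta> A C = convex hull ({0} \<times> A \<union> {\<delta>} \<times> C)"

lemma attach_bottom_subset: "{0} \<times> A \<subseteq> attach \<delta> A C"
  and attach_top_subset: "{\<delta>} \<times> C \<subseteq> attach \<delta> A C"
  unfolding attach_def using hull_subset[of "{0} \<times> A \<union> {\<delta>} \<times> C" convex] by auto

lemma attach_zero_self: "convex A \<Longrightarrow> attach 0 A A = {0} \<times> A"
  by (simp add: attach_def convex_Times convex_hull_eq)

lemma convex_attach: "convex (attach \<delta> A C)"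
  by (simp add: attach_def)

lemma compact_attach: "compact A \<Longrightarrow> compact C \<Longrightarrow> compact (attach \<delta> A C)"
  unfolding attach_def by (intro compact_convex_hull compact_Un compact_Times compact_sing)

lemma attach_nonempty: "A \<noteq> {} \<Longrightarrow> attach \<delta> A C \<noteq> {}"
  using attach_bottom_subset[of A \<delta> C] by auto

text \<open>Both limits in \<open>is_remainder\<close> depend only on values near 0, because
  \<open>\<alpha> *\<^sub>R \<Delta>\<close> tends to 0 with \<open>\<alpha>\<close>. So expansions
  that agree merely for small increments can share their remainder condition.\<close>

lemma is_remainder_eventually_eq:
  fixes r r' :: "'a::euclidean_space \<Rightarrow> real"
  assumes "is_remainder r" and eq: "\<forall>\<^sub>F \<Delta> in nhds 0. r' \<Delta> = r \<Delta>"
  shows "is_remainder r'"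
  unfolding is_remainder_def
proof (intro conjI allI)
  have "\<forall>\<^sub>F \<Delta> in at 0. r \<Delta> = r' \<Delta>"
    using eq by (auto simp: eventually_at_filter elim: eventually_mono)
  then show "(r' \<longlongrightarrow> 0) (at 0)"
    using assms(1) unfolding is_remainder_def by (auto intro: Lim_transform_eventually)
next
  fix \<Delta> :: 'a
  have "((\<lambda>\<alpha>. \<alpha> *\<^sub>R \<Delta>) \<longlongrightarrow> 0 *\<^sub>R \<Delta>) (at_right 0)"
    by (intro tendsto_intros)
  then have "\<forall>\<^sub>F \<alpha> in at_right 0. r' (\<alpha> *\<^sub>R \<Delta>) = r (\<alpha> *\<^sub>R \<Delta>)"
    using eq by (auto simp: filterlim_iff)
  then have "\<forall>\<^sub>F \<alpha> in at_right 0. r (\<alpha> *\<^sub>R \<Delta>) / \<alpha> = r' (\<alpha> *\<^sub>R \<Delta>) / \<alpha>"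
    by (auto elim: eventually_mono)
  then show "((\<lambda>\<alpha>. r' (\<alpha> *\<^sub>R \<Delta>) / \<alpha>) \<longlongrightarrow> 0) (at_right 0)"
    using assms(1) unfolding is_remainder_def by (auto intro: Lim_transform_eventually)
qed

text \<open>A linear functional is bounded on a convex hull by its bound on the generators. Those
  over \<open>C\<close> carry the negative offset \<open>\<delta> * s\<close>, which outweighs the
  variation of the inner products once \<open>\<Delta>\<close> is small. The expansion itself uses
  \<open>s = 1\<close>; the value \<open>-1\<close> serves the reduction of infima to suprema. The
  alternative \<open>\<delta> = 0\<close> covers the centre, where both parts coincide.\<close>

lemma SUP_inner_attach:
  fixes A C :: "'a::euclidean_space set"
  assumes "bounded A" "A \<noteq> {}" "bounded C"
    and inactive: "\<delta> * s < 0 \<or> \<delta> = 0 \<and> C = A"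
  shows "\<exists>e>0. \<forall>\<Delta>. norm \<Delta> < e \<longrightarrow>
           (SUP p\<in>attach \<delta> A C. p \<bullet> (s, \<Delta>)) = (SUP v\<in>A. v \<bullet> \<Delta>)"
proof -
  obtain K where "K > 0" and K: "\<And>v. v \<in> A \<union> C \<Longrightarrow> norm v \<le> K"
    using assms(1,3) bounded_Un bounded_pos by metis
  have inner: "\<bar>v \<bullet> \<Delta>\<bar> \<le> K * norm \<Delta>" if "v \<in> A \<union> C" for v \<Delta>
    using Cauchy_Schwarz_ineq2[of v \<Delta>] mult_right_mono[OF K[OF that], of "norm \<Delta>"] by simp
  \<comment> \<open>For \<open>\<delta> = 0\<close> any radius works; otherwise this one makes the
    offset exceed \<open>2 * K * norm \<Delta>\<close>.\<close>
  define e where "e = (if \<delta> = 0 then 1 else - (\<delta> * s) / (2 * K))"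
  have "e > 0"
    using inactive \<open>K > 0\<close> by (auto simp: e_def intro: divide_neg_pos)
  moreover have "(SUP p\<in>attach \<delta> A C. p \<bullet> (s, \<Delta>)) = (SUP v\<in>A. v \<bullet> \<Delta>)"
    if "norm \<Delta> < e" for \<Delta>
  proof -
    define m where "m = (SUP v\<in>A. v \<bullet> \<Delta>)"
    have bdd: "bdd_above ((\<lambda>v. v \<bullet> \<Delta>) ` A)"
      using inner by (auto simp: abs_le_iff intro!: bdd_aboveI[where M = "K * norm \<Delta>"])
    have m: "v \<bullet> \<Delta> \<le> m" if "v \<in> A" for v
      unfolding m_def using bdd that by (rule cSUP_upper2) simp
    have top: "\<delta> * s + c \<bullet> \<Delta> \<le> m" if "c \<in> C" for c
    proof (cases "\<delta> = 0")
      case True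
      with inactive that m show ?thesis by auto
    next
      case False
      obtain v where "v \<in> A" using assms(2) by blast
      have "2 * K * norm \<Delta> < - (\<delta> * s)"
        using \<open>norm \<Delta> < e\<close> \<open>K > 0\<close> False by (simp add: e_def field_simps)
      \<comment> \<open>The chain is \<open>\<delta> * s + c \<bullet> \<Delta> < - 2 * K * norm
        \<Delta> + K * norm \<Delta> \<le> v \<bullet> \<Delta> \<le> m\<close>.\<close>
      with inner[of c \<Delta>] inner[of v \<Delta>] m[of v] \<open>v \<in> A\<close> that show ?thesis
        by auto
    qed
    have "attach \<delta> A C \<subseteq> {p. p \<bullet> (s, \<Delta>) \<le> m}"
      unfolding attach_def
    proof (rule hull_minimal)
      show "convex {p. p \<bullet> (s, \<Delta>) \<le> m}"
        using convex_halfspace_le[of "(s, \<Delta>)" m] by (simp add: inner_commute)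
    qed (use m top in auto)
    then have le: "p \<bullet> (s, \<Delta>) \<le> m" if "p \<in> attach \<delta> A C" for p
      using that by blast
    have "(SUP p\<in>attach \<delta> A C. p \<bullet> (s, \<Delta>)) \<le> m"
      using le attach_nonempty[OF assms(2)] by (intro cSUP_least) auto
    moreover have "m \<le> (SUP p\<in>attach \<delta> A C. p \<bullet> (s, \<Delta>))"
      unfolding m_def
    proof (rule cSUP_mono[OF assms(2)])
      show "bdd_above ((\<lambda>p. p \<bullet> (s, \<Delta>)) ` attach \<delta> A C)"
        using le by (auto intro!: bdd_aboveI)
      show "\<exists>p\<in>attach \<delta> A C. v \<bullet> \<Delta> \<le> p \<bullet> (s, \<Delta>)" if "v \<in> A" for v
        using attach_bottom_subset[of A \<delta> C] that by (intro bexI[of _ "(0, v)"]) auto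
    qed
    ultimately show ?thesis
      by (simp add: m_def)
  qed
  ultimately show ?thesis by blast
qed

text \<open>On the reals \<open>Inf\<close> is defined as the negated \<open>Sup\<close> of the
  negated set.\<close>

lemma INF_inner_eq_SUP:
  fixes \<Delta> :: "'a::real_inner"
  shows "(INF v\<in>A. v \<bullet> \<Delta>) = - (SUP v\<in>A. v \<bullet> (- \<Delta>))"
  by (simp add: Inf_real_def image_image)

lemma INF_inner_attach:
  fixes A C :: "'a::euclidean_space set"
  assumes "bounded A" "A \<noteq> {}" "bounded C"
    and "\<delta> * s > 0 \<or> \<delta> = 0 \<and> C = A"
  shows "\<exists>e>0. \<forall>\<Delta>. norm \<Delta> < e \<longrightarrow>
           (INF p\<in>attach \<delta> A C. p \<bullet> (s, \<Delta>)) = (INF v\<in>A. v \<bullet> \<Delta>)"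
proof -
  obtain e where "e > 0" and e: "\<And>\<Delta>. norm \<Delta> < e \<Longrightarrow>
      (SUP p\<in>attach \<delta> A C. p \<bullet> (- s, \<Delta>)) = (SUP v\<in>A. v \<bullet> \<Delta>)"
    using SUP_inner_attach[of A C \<delta> "- s"] assms by auto
  show ?thesis
    \<comment> \<open>The supremum result is taken at the increment \<open>- \<Delta>\<close>, which
      has the same norm, and \<open>(- s, - \<Delta>)\<close> is the negative of
      \<open>(s, \<Delta>)\<close>.\<close>
    using \<open>e > 0\<close> e[of "- _"] unfolding INF_inner_eq_SUP by (intro exI[of _ e]) simp
qed

text \<open>The signs of the heights put the attached part below the maximum and above the minimum,
  so for small increments neither extremum sees it and the quasidifferential expansion is
  recovered.\<close>

lemma has_codifferential_attach:
  fixes f :: "'a::euclidean_space \<Rightarrow> real"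
  assumes q: "has_quasidifferential f y A B"
    and C: "compact C" and D: "compact D"
    and \<delta>: "\<delta> > 0 \<or> \<delta> = 0 \<and> C = A \<and> D = B"
  shows "has_codifferential f y (attach (- \<delta>) A C) (attach \<delta> B D)"
proof -
  from q have A: "compact A" "A \<noteq> {}" and B: "compact B" "B \<noteq> {}"
    by (auto simp: has_quasidifferential_def)
  from q obtain r where r: "is_remainder r"
    and f: "\<And>\<Delta>. f (y + \<Delta>) = f y + (SUP v\<in>A. v \<bullet> \<Delta>) + (INF w\<in>B. w \<bullet> \<Delta>) + r \<Delta>"
    by (auto simp: has_quasidifferential_def)
  \<comment> \<open>This choice makes the new expansion exact for every increment, since
    \<open>(a, v) \<bullet> (1, \<Delta>) = a + v \<bullet> \<Delta>\<close>. Agreement with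
    \<open>r\<close> is needed only near 0.\<close>
  define r' where "r' \<Delta> = f (y + \<Delta>) - f y - (SUP p\<in>attach (- \<delta>) A C. p \<bullet> (1, \<Delta>))
    - (INF p\<in>attach \<delta> B D. p \<bullet> (1, \<Delta>))" for \<Delta>
  obtain e1 where "e1 > 0" and e1: "\<And>\<Delta>. norm \<Delta> < e1 \<Longrightarrow>
      (SUP p\<in>attach (- \<delta>) A C. p \<bullet> (1, \<Delta>)) = (SUP v\<in>A. v \<bullet> \<Delta>)"
    using SUP_inner_attach[of A C "- \<delta>" 1] A C \<delta> by (auto simp: compact_imp_bounded)
  obtain e2 where "e2 > 0" and e2: "\<And>\<Delta>. norm \<Delta> < e2 \<Longrightarrow>
      (INF p\<in>attach \<delta> B D. p \<bullet> (1, \<Delta>)) = (INF w\<in>B. w \<bullet> \<Delta>)"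
    using INF_inner_attach[of B D \<delta> 1] B D \<delta> by (auto simp: compact_imp_bounded)
  have "\<forall>\<^sub>F \<Delta> in nhds 0. r' \<Delta> = r \<Delta>"
    unfolding eventually_nhds_metric
    using \<open>e1 > 0\<close> \<open>e2 > 0\<close> e1 e2 f
    by (intro exI[of _ "min e1 e2"]) (auto simp: r'_def)
  then have "is_remainder r'"
    by (rule is_remainder_eventually_eq[OF r])
  moreover have "f (y + \<Delta>) = f y + (SUP (a, v)\<in>attach (- \<delta>) A C. a + v \<bullet> \<Delta>)
      + (INF (b, w)\<in>attach \<delta> B D. b + w \<bullet> \<Delta>) + r' \<Delta>" for \<Delta>
    by (simp add: r'_def case_prod_beta inner_prod_def)
  ultimately show ?thesis
    using A B C D unfolding has_codifferential_def
    by (auto simp: convex_attach compact_attach attach_nonempty)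
qed

text \<open>The assumption \<open>near\<close> is one-sided: it controls the excess of
  \<open>A\<close> over \<open>C\<close>. The opposite excess is controlled by the attached copy, as
  \<open>(0, c)\<close> lies at distance \<open>\<bar>\<delta>\<bar>\<close> from
  \<open>(\<delta>, c)\<close>.\<close>

lemma hausdorff_distance_attach_le:
  fixes A C :: "'a::euclidean_space set"
  assumes "A \<noteq> {}" "C \<noteq> {}" "convex C"
    and near: "\<And>a. a \<in> A \<Longrightarrow> \<exists>c\<in>C. dist c a \<le> e" and \<delta>: "\<bar>\<delta>\<bar> \<le> e"
  shows "\<bar>hausdorff_distance (attach \<delta> A C) ({0} \<times> C)\<bar> \<le> e"
proof -
  \<comment> \<open>The closed \<open>e\<close>-neighbourhood is written as a Minkowski sum with a
    ball, so that it is visibly convex and contains the hull as soon as it contains the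
    generators.\<close>
  define N where "N = (\<Union>p\<in>{0::real} \<times> C. \<Union>q\<in>cball 0 e. {p + q})"
  have N: "q \<in> N" if "p \<in> {0} \<times> C" "dist p q \<le> e" for p q
  proof -
    have "q - p \<in> cball 0 e" "q = p + (q - p)"
      using that(2) by (auto simp: dist_norm norm_minus_commute)
    with that(1) show ?thesis unfolding N_def by blast
  qed
  have "attach \<delta> A C \<subseteq> N"
    unfolding attach_def
  proof (rule hull_minimal)
    show "convex N"
      unfolding N_def using assms(3) by (intro convex_sums convex_Times) auto
    have "q \<in> N" if "q \<in> {0} \<times> A" for q
    proof -
      obtain a where "a \<in> A" "q = (0, a)" using \<open>q \<in> {0} \<times> A\<close> by auto
      moreover obtain c where "c \<in> C" "dist c a \<le> e" using near \<open>a \<in> A\<close> by blast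
      ultimately show ?thesis by (intro N[of "(0, c)"]) (auto simp: dist_Pair_Pair)
    qed
    moreover have "q \<in> N" if "q \<in> {\<delta>} \<times> C" for q
      using that \<delta> by (intro N[of "(0, snd q)"]) (auto simp: dist_Pair_Pair)
    ultimately show "{0} \<times> A \<union> {\<delta>} \<times> C \<subseteq> N" by blast
  qed
  have 1: "infdist p ({0} \<times> C) \<le> e" if "p \<in> attach \<delta> A C" for p
  proof -
    have "p \<in> N" using \<open>attach \<delta> A C \<subseteq> N\<close> that ..
    then obtain q u where "q \<in> {0} \<times> C" "u \<in> cball 0 e" "p = q + u"
      unfolding N_def by (elim UN_E singletonE)
    then show ?thesis
      by (intro infdist_le2[of q]) (auto simp: dist_norm)
  qed
  have 2: "infdist p (attach \<delta> A C) \<le> e" if "p \<in> {0} \<times> C" for p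
  proof (rule infdist_le2)
    show "(\<delta>, snd p) \<in> attach \<delta> A C"
      using attach_top_subset[of \<delta> C A] that by auto
    show "dist p (\<delta>, snd p) \<le> e"
      using that \<delta> by (auto simp: dist_Pair_Pair)
  qed
  have "(SUP p\<in>attach \<delta> A C. infdist p ({0} \<times> C)) \<le> e"
    using 1 attach_nonempty[OF assms(1)] by (intro cSUP_least) auto
  moreover have "(SUP p\<in>{0} \<times> C. infdist p (attach \<delta> A C)) \<le> e"
    using 2 assms(2) by (intro cSUP_least) auto
  moreover obtain c where "c \<in> C" using assms(2) by blast
  \<comment> \<open>Nonnegativity of one of the two suprema makes their maximum nonnegative, which
    gives the absolute value in the claim.\<close>
  have "0 \<le> (SUP p\<in>{0} \<times> C. infdist p (attach \<delta> A C))"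
    using 2 \<open>c \<in> C\<close> by (intro cSUP_upper2[of _ _ "(0, c)"] bdd_aboveI2[where M = e])
      (auto simp: infdist_nonneg)
  ultimately show ?thesis
    by (simp add: hausdorff_distance_def)
qed

text \<open>Upper semicontinuity supplies the one-sided closeness of \<open>F y\<close> to
  \<open>F x\<close>, and the vanishing height \<open>d y\<close> supplies the rest. Since
  \<open>d x = 0\<close>, the value at \<open>x\<close> collapses to
  \<open>{0} \<times> F x\<close>.\<close>

lemma hausdorff_continuous_at_attach:
  fixes F :: "'a::metric_space \<Rightarrow> 'b::euclidean_space set"
  assumes usc: "upper_semicontinuous_at F x"
    and ne: "\<And>y. F y \<noteq> {}" and "convex (F x)"
    and d: "(d \<longlongrightarrow> 0) (at x)" "d x = 0"
  shows "hausdorff_continuous_at (\<lambda>y. attach (d y) (F y) (F x)) x"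
  unfolding hausdorff_continuous_at_def
proof (rule tendstoI)
  fix e :: real
  assume "e > 0"
  \<comment> \<open>Radius \<open>e/2\<close> leaves room to turn the non-strict distance bound into
    a strict one.\<close>
  have "open (\<Union>c\<in>F x. ball c (e/2))" "F x \<subseteq> (\<Union>c\<in>F x. ball c (e/2))"
    using \<open>e > 0\<close> by auto
  with usc have "\<forall>\<^sub>F y in nhds x. F y \<subseteq> (\<Union>c\<in>F x. ball c (e/2))"
    unfolding upper_semicontinuous_at_def by blast
  then have "\<forall>\<^sub>F y in at x. F y \<subseteq> (\<Union>c\<in>F x. ball c (e/2))"
    by (auto simp: eventually_at_filter elim: eventually_mono)
  moreover have "\<forall>\<^sub>F y in at x. dist (d y) 0 < e/2"
    using tendstoD[OF d(1), of "e/2"] \<open>e > 0\<close> by simp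
  ultimately show "\<forall>\<^sub>F y in at x. dist (hausdorff_distance
      (attach (d y) (F y) (F x)) (attach (d x) (F x) (F x))) 0 < e"
  proof eventually_elim
    case (elim y)
    have "\<bar>hausdorff_distance (attach (d y) (F y) (F x)) ({0} \<times> F x)\<bar> \<le> e/2"
      using elim ne assms(3) by (intro hausdorff_distance_attach_le) (force intro: less_imp_le)+
    with \<open>e > 0\<close> show ?case
      by (simp add: d(2) attach_zero_self[OF assms(3)])
  qed
qed

theorem theorem6p2:
  fixes f :: "real ^ 'n \<Rightarrow> real"
    and subdiff superdiff :: "real ^ 'n \<Rightarrow> (real ^ 'n) set"
    and x :: "real ^ 'n"
  assumes "\<exists>L. L-lipschitz_on UNIV f"
    and "\<forall>y. has_quasidifferential f y (subdiff y) (superdiff y)"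
    and "upper_semicontinuous_at subdiff x"
    and "upper_semicontinuous_at superdiff x"
  shows "continuously_codifferentiable_at f x"
proof -
  have sets: "convex (subdiff y)" "compact (subdiff y)" "subdiff y \<noteq> {}"
    "convex (superdiff y)" "compact (superdiff y)" "superdiff y \<noteq> {}" for y
    using assms(2) by (auto simp: has_quasidifferential_def)
  have lim: "((\<lambda>y. dist y x) \<longlongrightarrow> 0) (at x)"
    using tendsto_dist[OF tendsto_ident_at tendsto_const, of x x UNIV] by simp
  have "hausdorff_continuous_at (\<lambda>y. attach (- dist y x) (subdiff y) (subdiff x)) x"
    using tendsto_minus[OF lim] sets
    by (intro hausdorff_continuous_at_attach[OF assms(3)]) auto
  moreover have "hausdorff_continuous_at (\<lambda>y. attach (dist y x) (superdiff y) (superdiff x)) x"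
    using lim sets by (intro hausdorff_continuous_at_attach[OF assms(4)]) auto
  \<comment> \<open>For \<open>y = x\<close> the height is 0 and the attached sets are those of
    \<open>y\<close> itself; for every other \<open>y\<close> the height is positive. Hence the
    whole space serves as the neighbourhood of \<open>x\<close>.\<close>
  moreover have "has_codifferential f y (attach (- dist y x) (subdiff y) (subdiff x))
      (attach (dist y x) (superdiff y) (superdiff x))" for y
    using assms(2) sets by (intro has_codifferential_attach) auto
  ultimately show ?thesis
    unfolding continuously_codifferentiable_at_def
    by (intro exI conjI ballI) (rule open_UNIV UNIV_I | assumption)+
qed

end
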